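(* Let $p,q\in V$ be two distinct variables. Then (i) $\{p,\neg p\}\not\vdash_{\mathbf{vD}}q$; (ii) $\{\circ p,p\}\not\vdash_{\mathbf{vD}}q$; (iii) $\{\circ p,\neg p\}\not\vdash_{\mathbf{vD}}q$.
   Context: Let $V$ be a denumerable set of propositional variables and $\mathcal{L}$ the set of formulas generated from $V$ by the binary connectives $\land,\lor,\longrightarrow$ and the unary connectives $\neg,\circ$. Fix a formula $\beta_0$ and set $\bot:=\beta_0\land(\neg\beta_0\land\circ\beta_0)$; for every formula $\alpha$ let $\sim\alpha$ abbreviate $\alpha\longrightarrow\bot$. The logic $\mathbf{vD}$ has axiom schemas (for all $\alpha,\beta,\gamma$, $\to$ denoting $\longrightarrow$): (1) $\alpha\to(\beta\to\alpha)$; (2) $(\alpha\to(\beta\to\gamma))\to((\alpha\to\beta)\to(\alpha\to\gamma))$; (3) $\alpha\to(\beta\to(\alpha\land\beta))$; (4) $(\alpha\land\beta)\to\alpha$; (5) $(\alpha\land\beta)\to\beta$; (6) $\alpha\to(\alpha\lor\beta)$; (7) $\beta\to(\alpha\lor\beta)$; (8) $(\alpha\to\beta)\lor\alpha$; (9) $\alpha\lor\neg\alpha$; (10) $(\alpha\to\gamma)\to((\neg\alpha\to\gamma)\to((\alpha\lor\neg\alpha)\to\gamma))$; (11) $((\alpha\to\beta)\to\gamma)\to((\alpha\to\gamma)\to(((\alpha\to\beta)\lor\alpha)\to\gamma))$; (12) $\circ\alpha\to(\alpha\to(\neg\alpha\to\beta))$; (13) $\circ\alpha\lor(\alpha\land\neg\alpha)$;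 (14) $(\circ\alpha\to\gamma)\to(((\alpha\land\neg\alpha)\to\gamma)\to((\circ\alpha\lor(\alpha\land\neg\alpha))\to\gamma))$; (15) $\sim\neg\alpha\to\sim\neg\sim\neg\alpha$; (16) $\sim\neg\sim\neg\alpha\to\sim\neg\alpha$; (17) $\sim\neg(\alpha\land\beta)\to(\sim\neg\alpha\land\sim\neg\beta)$; (18) $(\sim\neg\alpha\land\sim\neg\beta)\to\sim\neg(\alpha\land\beta)$; rules: (MP) from $\alpha$, $\alpha\longrightarrow\beta$ infer $\beta$; (N) from $\alpha$ infer $\neg\alpha\longrightarrow\sim\alpha$, applicable only when $\alpha$ is a theorem. A derivation of $\varphi$ from $\Gamma$ is a finite sequence ending in $\varphi$ each member of which is an axiom instance, a member of $\Gamma$, obtained by MP from earlier members, or obtained by (N) from an earlier member that is a theorem (derivable from $\emptyset$). $\Gamma\vdash_{\mathbf{vD}}\varphi$ iff such a derivation exists. *)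

theory Defs
  imports Main "HOL-Library.Countable" "HOL-Library.Infinite_Typeclass"
begin

datatype 'v fm =
    Var 'v
  | Conj "'v fm" "'v fm"  (infixr "\<^bold>\<and>" 75)
  | Disj "'v fm" "'v fm"  (infixr "\<^bold>\<or>" 70)
  | Imp "'v fm" "'v fm"  (infixr "\<^bold>\<longrightarrow>" 65)
  | Neg "'v fm"  ("\<^bold>\<not> _" [80] 80)
  | Circ "'v fm"  ("\<^bold>\<circ> _" [80] 80)

text \<open>The formula \<open>b\<close> below is the arbitrary but fixed formula \<open>\<beta>\<^sub>0\<close> from which falsum, and hence
  the defined negation \<open>\<sim>\<close>, are built.\<close>

definition falsum :: "'v fm \<Rightarrow> 'v fm" where
  "falsum b = b \<^bold>\<and> (\<^bold>\<not> b \<^bold>\<and> \<^bold>\<circ> b)"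

definition sneg :: "'v fm \<Rightarrow> 'v fm \<Rightarrow> 'v fm" where
  "sneg b \<alpha> = \<alpha> \<^bold>\<longrightarrow> falsum b"

inductive vD_axiom :: "'v fm \<Rightarrow> 'v fm \<Rightarrow> bool" for b :: "'v fm" where
  Ax1: "vD_axiom b (\<alpha> \<^bold>\<longrightarrow> (\<beta> \<^bold>\<longrightarrow> \<alpha>))"
| Ax2: "vD_axiom b ((\<alpha> \<^bold>\<longrightarrow> (\<beta> \<^bold>\<longrightarrow> \<gamma>)) \<^bold>\<longrightarrow> ((\<alpha> \<^bold>\<longrightarrow> \<beta>) \<^bold>\<longrightarrow> (\<alpha> \<^bold>\<longrightarrow> \<gamma>)))"
| Ax3: "vD_axiom b (\<alpha> \<^bold>\<longrightarrow> (\<beta> \<^bold>\<longrightarrow> (\<alpha> \<^bold>\<and> \<beta>)))"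
| Ax4: "vD_axiom b ((\<alpha> \<^bold>\<and> \<beta>) \<^bold>\<longrightarrow> \<alpha>)"
| Ax5: "vD_axiom b ((\<alpha> \<^bold>\<and> \<beta>) \<^bold>\<longrightarrow> \<beta>)"
| Ax6: "vD_axiom b (\<alpha> \<^bold>\<longrightarrow> (\<alpha> \<^bold>\<or> \<beta>))"
| Ax7: "vD_axiom b (\<beta> \<^bold>\<longrightarrow> (\<alpha> \<^bold>\<or> \<beta>))"
| Ax8: "vD_axiom b ((\<alpha> \<^bold>\<longrightarrow> \<beta>) \<^bold>\<or> \<alpha>)"
| Ax9: "vD_axiom b (\<alpha> \<^bold>\<or> \<^bold>\<not> \<alpha>)"
| Ax10: "vD_axiom b ((\<alpha> \<^bold>\<longrightarrow> \<gamma>) \<^bold>\<longrightarrow> ((\<^bold>\<not> \<alpha> \<^bold>\<longrightarrow> \<gamma>) \<^bold>\<longrightarrow> ((\<alpha> \<^bold>\<or> \<^bold>\<not> \<alpha>) \<^bold>\<longrightarrow> \<gamma>)))"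
| Ax11: "vD_axiom b (((\<alpha> \<^bold>\<longrightarrow> \<beta>) \<^bold>\<longrightarrow> \<gamma>) \<^bold>\<longrightarrow> ((\<alpha> \<^bold>\<longrightarrow> \<gamma>) \<^bold>\<longrightarrow> (((\<alpha> \<^bold>\<longrightarrow> \<beta>) \<^bold>\<or> \<alpha>) \<^bold>\<longrightarrow> \<gamma>)))"
| Ax12: "vD_axiom b (\<^bold>\<circ> \<alpha> \<^bold>\<longrightarrow> (\<alpha> \<^bold>\<longrightarrow> (\<^bold>\<not> \<alpha> \<^bold>\<longrightarrow> \<beta>)))"
| Ax13: "vD_axiom b (\<^bold>\<circ> \<alpha> \<^bold>\<or> (\<alpha> \<^bold>\<and> \<^bold>\<not> \<alpha>))"
| Ax14: "vD_axiom b ((\<^bold>\<circ> \<alpha> \<^bold>\<longrightarrow> \<gamma>) \<^bold>\<longrightarrow> (((\<alpha> \<^bold>\<and> \<^bold>\<not> \<alpha>) \<^bold>\<longrightarrow> \<gamma>) \<^bold>\<longrightarrow> ((\<^bold>\<circ> \<alpha> \<^bold>\<or> (\<alpha> \<^bold>\<and> \<^bold>\<not> \<alpha>)) \<^bold>\<longrightarrow> \<gamma>)))"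
| Ax15: "vD_axiom b (sneg b (\<^bold>\<not> \<alpha>) \<^bold>\<longrightarrow> sneg b (\<^bold>\<not> (sneg b (\<^bold>\<not> \<alpha>))))"
| Ax16: "vD_axiom b (sneg b (\<^bold>\<not> (sneg b (\<^bold>\<not> \<alpha>))) \<^bold>\<longrightarrow> sneg b (\<^bold>\<not> \<alpha>))"
| Ax17: "vD_axiom b (sneg b (\<^bold>\<not> (\<alpha> \<^bold>\<and> \<beta>)) \<^bold>\<longrightarrow> (sneg b (\<^bold>\<not> \<alpha>) \<^bold>\<and> sneg b (\<^bold>\<not> \<beta>)))"
| Ax18: "vD_axiom b ((sneg b (\<^bold>\<not> \<alpha>) \<^bold>\<and> sneg b (\<^bold>\<not> \<beta>)) \<^bold>\<longrightarrow> sneg b (\<^bold>\<not> (\<alpha> \<^bold>\<and> \<beta>)))"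

text \<open>\<open>derivation b \<Gamma> xs\<close>: every member of the sequence \<open>xs\<close> is an axiom, a hypothesis, or follows
  from earlier members. In rule \<open>N\<close> the sequence \<open>ys @ [\<alpha>]\<close> witnesses that the earlier member \<open>\<alpha>\<close>
  is a theorem; this reference to derivations from the empty set is why \<open>\<Gamma>\<close> is not a fixed
  parameter of the induction.\<close>

inductive derivation :: "'v fm \<Rightarrow> 'v fm set \<Rightarrow> 'v fm list \<Rightarrow> bool" for b :: "'v fm" where
  Empty: "derivation b \<Gamma> []"
| Axiom: "derivation b \<Gamma> xs \<Longrightarrow> vD_axiom b \<alpha> \<Longrightarrow> derivation b \<Gamma> (xs @ [\<alpha>])"
| Hyp: "derivation b \<Gamma> xs \<Longrightarrow> \<alpha> \<in> \<Gamma> \<Longrightarrow> derivation b \<Gamma> (xs @ [\<alpha>])"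
| MP: "derivation b \<Gamma> xs \<Longrightarrow> \<alpha> \<in> set xs \<Longrightarrow> (\<alpha> \<^bold>\<longrightarrow> \<beta>) \<in> set xs \<Longrightarrow> derivation b \<Gamma> (xs @ [\<beta>])"
| N: "derivation b \<Gamma> xs \<Longrightarrow> \<alpha> \<in> set xs \<Longrightarrow> derivation b {} (ys @ [\<alpha>]) \<Longrightarrow>
      derivation b \<Gamma> (xs @ [\<^bold>\<not> \<alpha> \<^bold>\<longrightarrow> sneg b \<alpha>])"

definition vD_derives :: "'v fm \<Rightarrow> 'v fm set \<Rightarrow> 'v fm \<Rightarrow> bool" where
  "vD_derives b \<Gamma> \<phi> \<longleftrightarrow> (\<exists>xs. derivation b \<Gamma> (xs @ [\<phi>]))"

end

theory Submission
  imports Defs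
begin

text \<open>Read \<open>\<^bold>\<not>\<close> as ``possibly not'' in a Kripke model whose accessibility relation is total, and
  \<open>\<^bold>\<circ> \<alpha>\<close> as the negation of \<open>\<alpha> \<^bold>\<and> \<^bold>\<not> \<alpha>\<close>. Then falsum holds nowhere, \<open>\<sim>\<^bold>\<not>\<close> is the S5 necessity
  operator, axioms 15--18 express its idempotence and its compatibility with conjunction, and rule
  \<open>N\<close> is sound because theorems hold at every world. Each claim is then refuted at a world of a
  two-world model; a second world is needed to make \<open>p\<close> and \<open>\<^bold>\<not> p\<close> hold together.\<close>

primrec sat :: "('w \<Rightarrow> 'v \<Rightarrow> bool) \<Rightarrow> 'w \<Rightarrow> 'v fm \<Rightarrow> bool" where
  "sat V w (Var x) \<longleftrightarrow> V w x"
| "sat V w (\<alpha> \<^bold>\<and> \<beta>) \<longleftrightarrow> sat V w \<alpha> \<and> sat V w \<beta>"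
| "sat V w (\<alpha> \<^bold>\<or> \<beta>) \<longleftrightarrow> sat V w \<alpha> \<or> sat V w \<beta>"
| "sat V w (\<alpha> \<^bold>\<longrightarrow> \<beta>) \<longleftrightarrow> (sat V w \<alpha> \<longrightarrow> sat V w \<beta>)"
| "sat V w (\<^bold>\<not> \<alpha>) \<longleftrightarrow> (\<exists>u. \<not> sat V u \<alpha>)"
| "sat V w (\<^bold>\<circ> \<alpha>) \<longleftrightarrow> (sat V w \<alpha> \<longrightarrow> (\<forall>u. sat V u \<alpha>))"

text \<open>If \<open>b\<close> and its consistency hold at one world, \<open>b\<close> holds at
  all, so its negation fails.\<close>

lemma not_sat_falsum: "\<not> sat V w (falsum b)"
  by (auto simp: falsum_def)

lemma sat_sneg: "sat V w (sneg b \<alpha>) \<longleftrightarrow> \<not> sat V w \<alpha>"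
  by (simp add: sneg_def not_sat_falsum)

lemma vD_axiom_sound: "vD_axiom b \<alpha> \<Longrightarrow> sat V w \<alpha>"
  by (induction rule: vD_axiom.induct) (auto simp: sat_sneg)

lemma derivation_sound:
  assumes "derivation b \<Gamma> xs" and "\<forall>\<gamma>\<in>\<Gamma>. sat V w \<gamma>" and "\<phi> \<in> set xs"
  shows "sat V w \<phi>"
  using assms
proof (induction arbitrary: w \<phi> rule: derivation.induct)
  case (MP \<Gamma> xs \<alpha> \<beta>)
  then show ?case
    by (metis Un_iff empty_iff insert_iff list.set sat.simps(4) set_append)
next
  case (N \<Gamma> xs \<alpha> ys)
  \<comment> \<open>The derivation witnessing a theorem has no hypotheses, so its induction
    hypothesis applies at every world; hence \<open>w\<close> is generalized.\<close>
  have "sat V u \<alpha>" for u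
    using N.IH(2) by simp
  then show ?case
    using N by (auto simp: sat_sneg)
qed (auto simp: vD_axiom_sound)

lemma vD_derives_sound:
  assumes "vD_derives b \<Gamma> \<phi>" and "\<forall>\<gamma>\<in>\<Gamma>. sat V w \<gamma>"
  shows "sat V w \<phi>"
  using assms derivation_sound[of b \<Gamma> _ V w \<phi>] by (auto simp: vD_derives_def)

theorem theorem5p2:
  fixes \<beta>\<^sub>0 :: "'v::{countable,infinite} fm" and p q :: 'v
  assumes "p \<noteq> q"
  shows "\<not> vD_derives \<beta>\<^sub>0 {Var p, \<^bold>\<not> (Var p)} (Var q) \<and>
         \<not> vD_derives \<beta>\<^sub>0 {\<^bold>\<circ> (Var p), Var p} (Var q) \<and>
         \<not> vD_derives \<beta>\<^sub>0 {\<^bold>\<circ> (Var p), \<^bold>\<not> (Var p)} (Var q)"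
proof (intro conjI notI)
  assume "vD_derives \<beta>\<^sub>0 {Var p, \<^bold>\<not> (Var p)} (Var q)"
  \<comment> \<open>The worlds are the booleans; \<open>p\<close> fails at \<open>False\<close>,
    which makes its negation true at \<open>True\<close>.\<close>
  from vD_derives_sound[OF this, of "\<lambda>w x. w \<and> x = p" True] show False
    using assms by auto
next
  assume "vD_derives \<beta>\<^sub>0 {\<^bold>\<circ> (Var p), Var p} (Var q)"
  from vD_derives_sound[OF this, of "\<lambda>(w::bool) x. x = p" True] show False
    using assms by auto
next
  assume "vD_derives \<beta>\<^sub>0 {\<^bold>\<circ> (Var p), \<^bold>\<not> (Var p)} (Var q)"
  \<comment> \<open>As \<open>p\<close> fails at \<open>True\<close>, its consistency holds there
    vacuously.\<close>
  from vD_derives_sound[OF this, of "\<lambda>(w::bool) x. False" True] show False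
    by auto
qed

end
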